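(* Let $A$ be a right nilpotent skew left brace of nilpotent type (i.e. the additive group $(A,+)$ is nilpotent) and let $I$ be a non-zero ideal of $A$. Then $I\cap\mathrm{Soc}(A)\neq 0$.
   Context: A skew left brace is a triple $(A,+,\circ)$ where $(A,+)$ and $(A,\circ)$ are (not necessarily abelian) groups such that $a\circ(b+c)=a\circ b-a+a\circ c$ for all $a,b,c\in A$. The two groups share the same neutral element $0$. For $a,b\in A$ put $\lambda_a(b)=-a+a\circ b$ and $a*b=-a+a\circ b-b$. For subsets $X,Y\subseteq A$, $X*Y$ denotes the subgroup of $(A,+)$ generated by all $x*y$ with $x\in X$, $y\in Y$. The right series of $A$ is $A^{(1)}=A$, $A^{(n+1)}=A^{(n)}*A$ for $n\ge 1$; $A$ is right nilpotent if $A^{(m)}=0$ for some $m\ge 1$. An ideal of $A$ is a subgroup $I$ of $(A,+)$ such that $\lambda_a(I)\subseteq I$, $a\circ I=I\circ a$ and $a+I=I+a$ for all $a\in A$. The socle of $A$ is $\mathrm{Soc}(A)=\{x\in A: x\circ a=x+a \text{ and } x+a=a+x \text{ for all } a\in A\}$. *)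

theory Defs
  imports "HOL-Algebra.Algebra"
begin

section \<open>Nilpotent groups\<close>

text \<open>
  Indices are shifted: \<open>lower_central_series G n\<close> is the subgroup usually written
  \<open>\<gamma>\<close> with index \<open>n + 1\<close>, so the series starts at \<open>carrier G\<close> for \<open>n = 0\<close>.
\<close>

primrec lower_central_series :: "('a, 'b) monoid_scheme \<Rightarrow> nat \<Rightarrow> 'a set" where
  "lower_central_series G 0 = carrier G"
| "lower_central_series G (Suc n) =
     generate G {x \<otimes>\<^bsub>G\<^esub> y \<otimes>\<^bsub>G\<^esub> inv\<^bsub>G\<^esub> x \<otimes>\<^bsub>G\<^esub> inv\<^bsub>G\<^esub> y | x y.
       x \<in> lower_central_series G n \<and> y \<in> carrier G}"

locale nilpotent_group = group +
  assumes nilpotent: "\<exists>n. lower_central_series G n = {\<one>}"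

section \<open>Skew left braces\<close>

text \<open>
  The record type \<open>ring\<close> serves only as a carrier with two operations: \<open>\<oplus>\<close> is the
  additive group operation, which need not be commutative, and \<open>\<otimes>\<close> is the circle
  operation. The fields \<open>\<zero>\<close> and \<open>\<one>\<close> are the neutral elements of the two groups; they
  coincide by the lemma \<open>one_eq_zero\<close> below.
\<close>

locale skew_left_brace =
  fixes A (structure)
  assumes additive_group: "group (add_monoid A)"
    and circle_group: "group A"
    and brace_distrib:
      "\<lbrakk>a \<in> carrier A; b \<in> carrier A; c \<in> carrier A\<rbrakk>
        \<Longrightarrow> a \<otimes> (b \<oplus> c) = (a \<otimes> b) \<ominus> a \<oplus> (a \<otimes> c)"

lemma (in skew_left_brace) one_eq_zero: "\<one> = \<zero>"
proof -
  interpret add: group "add_monoid A" by (rule additive_group)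
  interpret circle: group A by (rule circle_group)
  have z: "\<zero> \<in> carrier A" using add.one_closed by simp
  have zz: "\<zero> \<oplus> \<zero> = \<zero>" using add.l_one z by simp
  have i: "\<ominus> \<one> \<in> carrier A" using add.inv_closed[of \<one>] by (simp add: a_inv_def)
  have "\<one> \<otimes> (\<zero> \<oplus> \<zero>) = (\<one> \<otimes> \<zero>) \<ominus> \<one> \<oplus> (\<one> \<otimes> \<zero>)"
    by (rule brace_distrib) (use z in auto)
  then have "\<zero> = \<zero> \<oplus> (\<ominus> \<one>) \<oplus> \<zero>"
    using z zz by (simp add: a_minus_def)
  also have "\<dots> = \<ominus> \<one>"
    using add.l_one[of "\<ominus> \<one>"] add.r_one[of "\<ominus> \<one>"] i by simp
  finally have e: "\<ominus> \<one> = \<zero>" by simp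
  have "\<one> \<oplus> \<ominus> \<one> = \<zero>"
    using add.r_inv[of \<one>] by (simp add: a_inv_def)
  then show ?thesis
    using e add.r_one[of \<one>] by simp
qed

definition brace_lambda :: "('a, 'b) ring_scheme \<Rightarrow> 'a \<Rightarrow> 'a \<Rightarrow> 'a" where
  "brace_lambda A a b = \<ominus>\<^bsub>A\<^esub> a \<oplus>\<^bsub>A\<^esub> (a \<otimes>\<^bsub>A\<^esub> b)"

definition brace_star :: "('a, 'b) ring_scheme \<Rightarrow> 'a \<Rightarrow> 'a \<Rightarrow> 'a" where
  "brace_star A a b = \<ominus>\<^bsub>A\<^esub> a \<oplus>\<^bsub>A\<^esub> (a \<otimes>\<^bsub>A\<^esub> b) \<ominus>\<^bsub>A\<^esub> b"

definition brace_star_set :: "('a, 'b) ring_scheme \<Rightarrow> 'a set \<Rightarrow> 'a set \<Rightarrow> 'a set" where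
  "brace_star_set A S T =
     generate (add_monoid A) {brace_star A x y | x y. x \<in> S \<and> y \<in> T}"

text \<open>
  The same index shift as above: \<open>right_series A n\<close> is the term of the right series with
  index \<open>n + 1\<close>.
\<close>

primrec right_series :: "('a, 'b) ring_scheme \<Rightarrow> nat \<Rightarrow> 'a set" where
  "right_series A 0 = carrier A"
| "right_series A (Suc n) = brace_star_set A (right_series A n) (carrier A)"

definition right_nilpotent :: "('a, 'b) ring_scheme \<Rightarrow> bool" where
  "right_nilpotent A \<longleftrightarrow> (\<exists>n. right_series A n = {\<zero>\<^bsub>A\<^esub>})"

definition brace_ideal :: "('a, 'b) ring_scheme \<Rightarrow> 'a set \<Rightarrow> bool" where
  "brace_ideal A I \<longleftrightarrow>
     subgroup I (add_monoid A) \<and>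
     (\<forall>a\<in>carrier A.
        brace_lambda A a ` I \<subseteq> I \<and>
        a <#\<^bsub>A\<^esub> I = I #>\<^bsub>A\<^esub> a \<and>
        a <+\<^bsub>A\<^esub> I = I +>\<^bsub>A\<^esub> a)"

definition brace_socle :: "('a, 'b) ring_scheme \<Rightarrow> 'a set" where
  "brace_socle A =
     {x \<in> carrier A. \<forall>a\<in>carrier A.
        x \<otimes>\<^bsub>A\<^esub> a = x \<oplus>\<^bsub>A\<^esub> a \<and> x \<oplus>\<^bsub>A\<^esub> a = a \<oplus>\<^bsub>A\<^esub> x}"

end

theory Submission
  imports Defs
begin

text \<open>
  The right series decreases to \<open>0\<close>, so there is a last term \<open>R\<close> that meets \<open>I\<close> nontrivially.
  As \<open>x * a\<close> lies in \<open>I\<close> and in the term after \<open>R\<close> for every \<open>x\<close> in \<open>I \<inter> R\<close>, all these elements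
  vanish. The identity \<open>b + a * c - b = - (a * b) + a * (b + c)\<close> shows that \<open>R\<close> is normal in the
  additive group, hence so is \<open>I \<inter> R\<close>, which therefore contains a non-zero central element since
  the additive group is nilpotent. Such an element belongs to the socle.
\<close>

text \<open>Conjugation by \<open>g\<close> is an automorphism, so generators decide normality;
  their conjugates have to lie in \<open>generate G H\<close> only, not in \<open>H\<close>
  itself.\<close>

lemma (in group) normal_generate_conjI:
  assumes "H \<subseteq> carrier G"
    and conj: "\<And>g h. \<lbrakk>g \<in> carrier G; h \<in> H\<rbrakk> \<Longrightarrow> g \<otimes> h \<otimes> inv g \<in> generate G H"
  shows "generate G H \<lhd> G"
proof (rule normal_invI)
  show sub: "subgroup (generate G H) G"
    using assms(1) by (rule generate_is_subgroup)
  fix g x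
  assume g: "g \<in> carrier G" and "x \<in> generate G H"
  from this(2) show "g \<otimes> x \<otimes> inv g \<in> generate G H"
  proof induction
    case one
    then show ?case using g by (simp add: generate.one)
  next
    case (incl h)
    then show ?case using conj g by blast
  next
    case (inv h)
    then have h: "h \<in> carrier G" using assms(1) by blast
    have "inv (g \<otimes> h \<otimes> inv g) \<in> generate G H"
      using conj[OF g inv] sub by (rule subgroup.m_inv_closed[rotated])
    then show ?case using g h by (simp add: inv_mult_group m_assoc)
  next
    case (eng x y)
    then have c: "x \<in> carrier G" "y \<in> carrier G"
      using generate_in_carrier[OF assms(1)] by auto
    have "g \<otimes> (x \<otimes> y) \<otimes> inv g = (g \<otimes> x \<otimes> inv g) \<otimes> (g \<otimes> y \<otimes> inv g)"
      using g c by (simp add: m_assoc inv_solve_left)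
    then show ?case using eng.IH by (simp add: generate.eng)
  qed
qed

text \<open>The last term of the lower central series that meets \<open>N\<close> nontrivially
  supplies \<open>x\<close>: its commutators lie in \<open>N\<close> by normality and in the next
  term by definition, hence are trivial.\<close>

lemma (in nilpotent_group) normal_meets_center:
  assumes "N \<lhd> G" and "N \<noteq> {\<one>}"
  obtains x where "x \<in> N" "x \<noteq> \<one>" "\<And>y. y \<in> carrier G \<Longrightarrow> x \<otimes> y = y \<otimes> x"
proof -
  interpret N: normal N G by (rule assms(1))
  let ?P = "\<lambda>n. N \<inter> lower_central_series G n = {\<one>}"
  obtain n where "?P n" using nilpotent N.one_closed by blast
  moreover have "\<not> ?P 0" using assms(2) N.subset by (auto simp: Int_absorb2)
  ultimately have "\<exists>k<n. (\<forall>i\<le>k. \<not> ?P i) \<and> ?P (Suc k)"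
    by (rule ex_least_nat_less)
  then obtain k where k: "\<not> ?P k" "?P (Suc k)" by blast
  \<comment> \<open>\<open>\<not> ?P k\<close> alone would allow an empty intersection; with
    \<open>\<one>\<close> in both sets it yields an element other than
    \<open>\<one>\<close>.\<close>
  have "\<one> \<in> lower_central_series G k"
    by (cases k) (auto intro: generate.one)
  with k(1) obtain x where x: "x \<in> N" "x \<in> lower_central_series G k" "x \<noteq> \<one>"
    using N.one_closed by blast
  show thesis
  proof
    show "x \<in> N" "x \<noteq> \<one>" by fact+
    fix y assume y: "y \<in> carrier G"
    have xc: "x \<in> carrier G" using x(1) N.subset by blast
    \<comment> \<open>The commutator is read as \<open>x\<close> times a conjugate of
      \<open>inv x\<close>.\<close>
    have "y \<otimes> inv x \<otimes> inv y \<in> N"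
      using N.inv_op_closed2 x(1) y by blast
    then have "x \<otimes> (y \<otimes> inv x \<otimes> inv y) \<in> N" using x(1) by blast
    then have "x \<otimes> y \<otimes> inv x \<otimes> inv y \<in> N" using xc y by (simp add: m_assoc)
    moreover have "x \<otimes> y \<otimes> inv x \<otimes> inv y \<in> lower_central_series G (Suc k)"
      using x(2) y by (auto intro!: generate.incl)
    ultimately have "x \<otimes> y \<otimes> inv x \<otimes> inv y = \<one>" using k(2) by blast
    then have "(x \<otimes> y) \<otimes> inv (y \<otimes> x) = \<one>"
      using xc y by (simp add: inv_mult_group m_assoc)
    from inv_equality[OF this] show "x \<otimes> y = y \<otimes> x" using xc y by simp
  qed
qed

context skew_left_brace
begin

text \<open>The rewrites state the group facts in the notation of the ring record, so that simp
  applies them to \<open>\<oplus>\<close> and \<open>\<ominus>\<close>.\<close>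

interpretation add: group "add_monoid A"
  rewrites "carrier (add_monoid A) = carrier A"
    and "monoid.mult (add_monoid A) = ring.add A"
    and "monoid.one (add_monoid A) = ring.zero A"
    and "m_inv (add_monoid A) = a_inv A"
  by (rule additive_group) (simp_all add: a_inv_def fun_eq_iff)

interpretation circle: group A by (rule circle_group)

lemma brace_star_closed:
  assumes "a \<in> carrier A" "b \<in> carrier A"
  shows "brace_star A a b \<in> carrier A"
  using assms by (simp add: brace_star_def a_minus_def)

lemma brace_star_eq_zero_iff:
  assumes "a \<in> carrier A" "b \<in> carrier A"
  shows "brace_star A a b = \<zero> \<longleftrightarrow> a \<otimes> b = a \<oplus> b"
proof -
  have "brace_star A a b = \<ominus> a \<oplus> (a \<otimes> b \<oplus> \<ominus> b)"
    using assms by (simp add: brace_star_def a_minus_def add.m_assoc)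
  then have "brace_star A a b = \<zero> \<longleftrightarrow> a \<otimes> b \<oplus> \<ominus> b = a"
    using assms add.inv_solve_left'[of \<zero> a "a \<otimes> b \<oplus> \<ominus> b"] by simp
  also have "\<dots> \<longleftrightarrow> a \<otimes> b = a \<oplus> b"
    using assms by (intro add.inv_solve_right') auto
  finally show ?thesis .
qed

text \<open>By \<open>brace_distrib\<close> the right-hand side is \<open>b - a \<otimes> b + a - a
  + a \<otimes> b - a + a \<otimes> c - c - b\<close>, where the terms before the second
  \<open>- a\<close> cancel down to \<open>b\<close>.\<close>

lemma conj_brace_star:
  assumes "a \<in> carrier A" "b \<in> carrier A" "c \<in> carrier A"
  shows "b \<oplus> brace_star A a c \<oplus> \<ominus> b = \<ominus> brace_star A a b \<oplus> brace_star A a (b \<oplus> c)"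
proof -
  \<comment> \<open>Sums are associated to the right, so neighbouring inverses cancel through rules
    that carry a tail \<open>y\<close>.\<close>
  have cancel: "\<ominus> x \<oplus> (x \<oplus> y) = y" "x \<oplus> (\<ominus> x \<oplus> y) = y" if "x \<in> carrier A" "y \<in> carrier A" for x y
    using that by (simp_all flip: add.m_assoc)
  show ?thesis
    using assms brace_distrib[OF assms]
    by (simp add: brace_star_def a_minus_def add.inv_mult_group add.m_assoc cancel)
qed

text \<open>By \<open>conj_brace_star\<close>, a conjugated generator is a combination of generators
  with second arguments \<open>b\<close> and \<open>b \<oplus> c\<close>; both are admissible
  because the second factor is the whole carrier.\<close>

lemma normal_brace_star_set:
  assumes "S \<subseteq> carrier A"
  shows "brace_star_set A S (carrier A) \<lhd> add_monoid A"
  unfolding brace_star_set_def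
proof (rule add.normal_generate_conjI)
  let ?H = "{brace_star A x y | x y. x \<in> S \<and> y \<in> carrier A}"
  show H: "?H \<subseteq> carrier A" using assms brace_star_closed by blast
  fix b h assume b: "b \<in> carrier A" and "h \<in> ?H"
  then obtain a c where a: "a \<in> S" and c: "c \<in> carrier A" and h: "h = brace_star A a c"
    by blast
  have "\<ominus> brace_star A a b \<oplus> brace_star A a (b \<oplus> c) \<in> generate (add_monoid A) ?H"
    using a b c
    by (intro add.generate_m_inv_closed[OF H] generate.eng[where G = "add_monoid A", simplified]
        generate.incl) auto
  then show "b \<oplus> h \<oplus> \<ominus> b \<in> generate (add_monoid A) ?H"
    using conj_brace_star[of a b c] a b c h assms by auto
qed

lemma normal_right_series: "right_series A n \<lhd> add_monoid A"
proof (induction n)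
  case 0
  show ?case using add.normal_self by simp
next
  case (Suc n)
  have "right_series A n \<subseteq> carrier A"
    using normal_imp_subgroup[OF Suc] subgroup.subset by fastforce
  then show ?case by (simp add: normal_brace_star_set)
qed

lemma brace_ideal_normal:
  assumes "brace_ideal A I"
  shows "I \<lhd> add_monoid A"
proof (rule add.normalI)
  show "subgroup I (add_monoid A)"
    using assms unfolding brace_ideal_def by blast
  show "\<forall>a\<in>carrier A. I #>\<^bsub>add_monoid A\<^esub> a = a <#\<^bsub>add_monoid A\<^esub> I"
    using assms unfolding brace_ideal_def a_l_coset_def a_r_coset_def by blast
qed

text \<open>Writing \<open>x \<otimes> a = a \<otimes> i\<close> with \<open>i \<in> I\<close> gives
  \<open>x * a = - x + (a + brace_lambda A a i - a)\<close>, a sum of two elements of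
  \<open>I\<close>.\<close>

lemma brace_star_in_ideal:
  assumes I: "brace_ideal A I" and x: "x \<in> I" and a: "a \<in> carrier A"
  shows "brace_star A x a \<in> I"
proof -
  interpret I: normal I "add_monoid A"
    rewrites "carrier (add_monoid A) = carrier A"
      and "monoid.mult (add_monoid A) = ring.add A"
      and "monoid.one (add_monoid A) = ring.zero A"
      and "m_inv (add_monoid A) = a_inv A"
    by (rule brace_ideal_normal[OF I]) (simp_all add: a_inv_def fun_eq_iff)
  have xc: "x \<in> carrier A" using x I.subset by blast
  have "x \<otimes> a \<in> a <# I"
    using I x a unfolding brace_ideal_def r_coset_def by blast
  then obtain i where i: "i \<in> I" "x \<otimes> a = a \<otimes> i"
    unfolding l_coset_def by blast
  have ic: "i \<in> carrier A" using i I.subset by blast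
  have lam: "brace_lambda A a i \<in> I"
    using I i(1) a unfolding brace_ideal_def by blast
  have "a \<oplus> brace_lambda A a i \<oplus> \<ominus> a \<in> I"
    using I.inv_op_closed2[OF a lam] .
  moreover have "a \<oplus> brace_lambda A a i = x \<otimes> a"
    using a ic xc unfolding brace_lambda_def i(2) by (simp flip: add.m_assoc)
  ultimately have "\<ominus> x \<oplus> (x \<otimes> a \<oplus> \<ominus> a) \<in> I"
    using x by auto
  then show ?thesis
    using a xc by (simp add: brace_star_def a_minus_def add.m_assoc)
qed

end

theorem theorem2p8:
  fixes A :: "('a, 'b) ring_scheme" and I :: "'a set"
  assumes "skew_left_brace A"
    and "right_nilpotent A"
    and "nilpotent_group (add_monoid A)"
    and "brace_ideal A I"
    and "I \<noteq> {\<zero>\<^bsub>A\<^esub>}"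
  shows "I \<inter> brace_socle A \<noteq> {\<zero>\<^bsub>A\<^esub>}"
proof -
  interpret skew_left_brace A by (rule assms(1))
  interpret add: nilpotent_group "add_monoid A" by (rule assms(3))
  let ?P = "\<lambda>n. I \<inter> right_series A n = {\<zero>\<^bsub>A\<^esub>}"
  have normal: "I \<inter> right_series A n \<lhd> add_monoid A" for n
    using brace_ideal_normal[OF assms(4)] normal_right_series by (rule add.normal_subgroup_intersect)
  have I: "subgroup I (add_monoid A)"
    using assms(4) unfolding brace_ideal_def by blast
  obtain n where "?P n"
    using assms(2) subgroup.one_closed[OF I] unfolding right_nilpotent_def by auto
  \<comment> \<open>The term of index \<open>0\<close> is the whole carrier and meets
    \<open>I\<close> in \<open>I\<close>, so the first index with \<open>?P\<close> is a
    successor.\<close>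
  moreover have "\<not> ?P 0"
    using assms(5) subgroup.subset[OF I] by (auto simp: Int_absorb2)
  ultimately have "\<exists>k<n. (\<forall>i\<le>k. \<not> ?P i) \<and> ?P (Suc k)"
    by (rule ex_least_nat_less)
  then obtain k where k: "\<not> ?P k" "?P (Suc k)" by blast
  \<comment> \<open>The central element is taken inside \<open>I \<inter> right_series A k\<close>
    rather than just \<open>I\<close>, so that each \<open>brace_star A x a\<close> falls into the
    next term.\<close>
  obtain x where x: "x \<in> I" "x \<in> right_series A k" "x \<noteq> \<zero>\<^bsub>A\<^esub>"
    and comm: "\<And>a. a \<in> carrier A \<Longrightarrow> x \<oplus>\<^bsub>A\<^esub> a = a \<oplus>\<^bsub>A\<^esub> x"
    using add.normal_meets_center[OF normal[of k]] k(1) by auto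
  have xc: "x \<in> carrier A" using x(1) subgroup.subset[OF I] by auto
  have "x \<otimes>\<^bsub>A\<^esub> a = x \<oplus>\<^bsub>A\<^esub> a" if a: "a \<in> carrier A" for a
  proof -
    have "brace_star A x a \<in> right_series A (Suc k)"
      using x(2) a by (auto simp: brace_star_set_def intro!: generate.incl)
    then have "brace_star A x a = \<zero>\<^bsub>A\<^esub>"
      using brace_star_in_ideal[OF assms(4) x(1) a] k(2) by blast
    then show ?thesis using brace_star_eq_zero_iff[OF xc a] by simp
  qed
  then have "x \<in> brace_socle A"
    using xc comm unfolding brace_socle_def by blast
  then show ?thesis using x by blast
qed

end
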